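(* Let $V\in\{0,1\}^{\mathbb{N}}$ be a Sturmian sequence and let $(X,\sigma)=(X_V,\sigma)$ be its associated shift system. Then $(X,\sigma)$ is not rank one; that is, there is no word $W\in\{0,1\}^{\mathbb{N}}$ with a rank-one construction such that $X=X_W$.
   Context: A Sturmian sequence is an element $V\in\{0,1\}^{\mathbb{N}}$ such that for every $n$ the number of words of length $n$ that are subwords of $V$ is $n+1$. For an infinite word $V$, $X_V=\{x\in\{0,1\}^{\mathbb{Z}}:\text{every finite subword of }x\text{ is a subword of }V\}$, with the shift $\sigma(x)(i)=x(i+1)$. Rank one: $\mathbb{N}$ is the set of nonnegative integers; $\mathcal{F}$ is the set of all finite binary words that start and end with $0$; $1^a$ is $a$ consecutive $1$s. A finite word $w$ is built from $v\in\mathcal{F}$ if $w=v1^{a_1}v1^{a_2}\cdots v1^{a_k}v$ for some $k\ge 1$ and $a_i\in\mathbb{N}$. An infinite word $W$ has a rank-one construction if there is a sequence $(v_i)_{i\in\mathbb{N}}$ in $\mathcal{F}$ with $v_0=0$, $v_{i+1}$ built from $v_i$ for all $i$, and $v_i$ an initial segment of $W$ for all $i$. *)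

theory Defs
  imports Main "HOL-Library.Z2"
begin

text \<open>The alphabet \<open>{0, 1}\<close> is the type \<^typ>\<open>bit\<close>; its arithmetic is not used.
  Subwords are contiguous blocks, and the empty word is a subword of every word.\<close>

definition subword :: "bit list \<Rightarrow> (nat \<Rightarrow> bit) \<Rightarrow> bool" where
  "subword u V \<longleftrightarrow> (\<exists>i. u = map (\<lambda>j. V (i + j)) [0..<length u])"

definition subword_Z :: "bit list \<Rightarrow> (int \<Rightarrow> bit) \<Rightarrow> bool" where
  "subword_Z u x \<longleftrightarrow> (\<exists>i. u = map (\<lambda>j. x (i + int j)) [0..<length u])"

definition sturmian :: "(nat \<Rightarrow> bit) \<Rightarrow> bool" where
  "sturmian V \<longleftrightarrow> (\<forall>n. card {u. length u = n \<and> subword u V} = n + 1)"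

definition shift :: "(int \<Rightarrow> bit) \<Rightarrow> (int \<Rightarrow> bit)" where
  "shift x = (\<lambda>i. x (i + 1))"

definition subshift :: "(nat \<Rightarrow> bit) \<Rightarrow> (int \<Rightarrow> bit) set" where
  "subshift V = {x. \<forall>u. subword_Z u x \<longrightarrow> subword u V}"

definition shift_system ::
    "(nat \<Rightarrow> bit) \<Rightarrow> (int \<Rightarrow> bit) set \<times> ((int \<Rightarrow> bit) \<Rightarrow> (int \<Rightarrow> bit))" where
  "shift_system V = (subshift V, shift)"

definition rank_one_words :: "bit list set" where
  "rank_one_words = {v. v \<noteq> [] \<and> hd v = 0 \<and> last v = 0}"

text \<open>The list \<open>as\<close> holds the exponents \<open>a\<^sub>1, \<dots>, a\<^sub>k\<close> with \<open>k \<ge> 1\<close>.\<close>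

definition built_from :: "bit list \<Rightarrow> bit list \<Rightarrow> bool" where
  "built_from w v \<longleftrightarrow>
     (\<exists>as. as \<noteq> [] \<and> w = concat (map (\<lambda>a. v @ replicate a 1) as) @ v)"

definition initial_segment :: "bit list \<Rightarrow> (nat \<Rightarrow> bit) \<Rightarrow> bool" where
  "initial_segment u W \<longleftrightarrow> u = map W [0..<length u]"

definition has_rank_one_construction :: "(nat \<Rightarrow> bit) \<Rightarrow> bool" where
  "has_rank_one_construction W \<longleftrightarrow>
     (\<exists>v :: nat \<Rightarrow> bit list.
        (\<forall>i. v i \<in> rank_one_words) \<and> v 0 = [0] \<and>
        (\<forall>i. built_from (v (Suc i)) (v i)) \<and> (\<forall>i. initial_segment (v i) W))"

definition rank_one_system ::
    "(int \<Rightarrow> bit) set \<times> ((int \<Rightarrow> bit) \<Rightarrow> (int \<Rightarrow> bit)) \<Rightarrow> bool" where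
  "rank_one_system S \<longleftrightarrow> (\<exists>W. has_rank_one_construction W \<and> S = shift_system W)"

end

theory Submission
  imports Defs "HOL-Library.Infinite_Set"
begin

text \<open>A Sturmian word has exactly one right special factor of each length, since the complexity
  grows by one. Suppose \<open>X\<^sub>V = X\<^sub>W\<close> with \<open>W\<close> rank one. As \<open>W\<close> is recurrent, its factors are
  factors of \<open>V\<close>, so \<open>W\<close> too has at most one right special factor of each length; and \<open>W\<close> is
  not periodic, because otherwise \<open>V\<close> would be eventually periodic.

  Uniqueness of right special factors forces the lengths of maximal runs of a letter to differ by
  at most one, so all spacers of \<open>W\<close> lie in \<open>{a, a + 1}\<close> and some \<open>v\<^sub>j\<close> is
  \<open>0 1\<^bsup>s\<^esup> 0 \<dots> 0\<close> with a spacer sequence \<open>u\<close> over the two letters \<open>a\<close> and \<open>a + 1\<close>,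
  both occurring. By aperiodicity both \<open>v\<^sub>j 1\<^bsup>a\<^esup> v\<^sub>j\<close> and \<open>v\<^sub>j 1\<^bsup>a+1\<^esup> v\<^sub>j\<close> are
  factors of \<open>W\<close>, that is, the language of spacer sequences contains \<open>u x u\<close> and \<open>u z u\<close>, where
  \<open>x\<close> is the first letter of \<open>u\<close> and \<open>z\<close> the other one. That language inherits the uniqueness of
  right special words. If \<open>u\<close> begins with exactly \<open>c \<ge> 1\<close> and ends with exactly \<open>d \<ge> 0\<close> letters
  \<open>x\<close>, these words contain maximal runs of \<open>x\<close> of lengths \<open>d + 1 + c\<close> and \<open>d\<close>, which differ by
  at least two.\<close>

section \<open>Languages with at most one right special word of each length\<close>

lemma bit_ne_cases: "x \<noteq> y \<Longrightarrow> (x = 0 \<and> y = 1) \<or> (x = 1 \<and> y = (0::bit))"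
  by (cases x; cases y) auto

text \<open>Serves three languages: the factors of the Sturmian word, the factors of the rank-one
  word, and the spacer words of \<open>derived_language\<close>.\<close>

locale special_unique_language =
  fixes L :: "bit list \<Rightarrow> bool"
  assumes factor: "L (p @ u @ q) \<Longrightarrow> L u"
    and special_unique: "\<lbrakk>L (u @ [0]); L (u @ [1]); L (w @ [0]); L (w @ [1]);
      length u = length w\<rbrakk> \<Longrightarrow> u = w"
begin

lemma special_unique':
  assumes "x \<noteq> y" "L (u @ [x])" "L (u @ [y])" "L (w @ [x])" "L (w @ [y])" "length u = length w"
  shows "u = w"
  using bit_ne_cases[OF assms(1)] assms(2-) special_unique by blast

text \<open>If \<open>r' \<ge> r + 2\<close>, then \<open>x # replicate r y\<close> and
  \<open>replicate (Suc r) y\<close> are right special of equal length but start with different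
  letters.\<close>

lemma run_length_le:
  assumes "x \<noteq> y" and r: "L (x # replicate r y @ [x])" and r': "L (x # replicate r' y @ [x])"
  shows "r' \<le> Suc r"
proof (rule ccontr)
  assume "\<not> ?thesis"
  then obtain k where k: "r' = Suc (Suc r) + k"
    by (metis le_Suc_ex not_less_eq_eq)
  have "L ((x # replicate r y) @ [x])"
    using r by simp
  moreover have "L ((x # replicate r y) @ [y])"
    using factor[of "[]" "(x # replicate r y) @ [y]" "replicate (Suc k) y @ [x]"] r' k
    by (simp add: replicate_add replicate_app_Cons_same)
  moreover have "L (replicate (Suc r) y @ [x])"
    using factor[of "x # replicate (Suc k) y" "replicate (Suc r) y @ [x]" "[]"] r' k
    by (simp add: replicate_add replicate_app_Cons_same add.commute flip: append_assoc)
  moreover have "L (replicate (Suc r) y @ [y])"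
    using factor[of "[x]" "replicate (Suc r) y @ [y]" "replicate k y @ [x]"] r' k
    by (simp add: replicate_add replicate_app_Cons_same)
  ultimately have "x # replicate r y = replicate (Suc r) y"
    using special_unique'[OF assms(1), of "x # replicate r y" "replicate (Suc r) y"] by simp
  with \<open>x \<noteq> y\<close> show False by simp
qed

lemma no_word_with_both_extensions:
  assumes "0 \<in> set s" "1 \<in> set s" "L (s @ 0 # s)" "L (s @ 1 # s)"
  shows False
proof -
  obtain x t where s: "s = x # t"
    using assms(1) by (cases s) auto
  obtain z where z: "z \<noteq> x" "z \<in> set s" "L (s @ z # s)" and x: "L (s @ x # s)"
    using assms by (cases x) auto
  have only: "c = x \<or> c = z" for c
    using z(1) by (cases c; cases x; cases z) auto
  obtain A B where AB: "s = A @ z # B" "z \<notin> set A"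
    using z(2) by (meson split_list_first)
  obtain C D where CD: "s = C @ z # D" "z \<notin> set D"
    using z(2) by (meson split_list_last)
  have A: "A = replicate (length A) x" and D: "D = replicate (length D) x"
    using AB(2) CD(2) only by (metis replicate_eqI)+
  \<comment> \<open>The run across the middle of \<open>s @ x # s\<close> consists of
    \<open>D\<close>, \<open>x\<close> and \<open>A\<close>, while \<open>D\<close> stands alone
    between two letters \<open>z\<close> in \<open>s @ z # s\<close>. As \<open>A\<close> is
    nonempty, the lengths differ by at least two.\<close>
  have "A \<noteq> []"
    using AB s z(1) by (cases A) auto
  have "L (z # (D @ [x] @ A) @ [z])"
    using factor[of C "z # (D @ [x] @ A) @ [z]" B] x
    by (metis AB(1) CD(1) append.assoc append_Cons append_Nil)
  then have "L (z # replicate (length D + Suc (length A)) x @ [z])"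
    using A D by (metis append_Cons append_Nil replicate_Suc replicate_add)
  moreover have "L (z # D @ [z])"
    using factor[of C "z # D @ [z]" s] z(3) CD(1) by simp
  then have "L (z # replicate (length D) x @ [z])"
    using D by metis
  ultimately have "length D + Suc (length A) \<le> Suc (length D)"
    using run_length_le z(1) by blast
  with \<open>A \<noteq> []\<close> show False by simp
qed

end

section \<open>Words built from a word by inserting spacers\<close>

text \<open>The empty list is allowed and gives \<open>v\<close>, so that chains can be split at any
  exponent and handled by induction.\<close>

definition chain :: "bit list \<Rightarrow> nat list \<Rightarrow> bit list" where
  "chain v as = concat (map (\<lambda>a. v @ replicate a 1) as) @ v"

lemma chain_Nil [simp]: "chain v [] = v"
  and chain_Cons: "chain v (a # as) = v @ replicate a 1 @ chain v as"
  by (simp_all add: chain_def)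

lemma chain_append_Cons: "chain v (as @ a # bs) = chain v as @ replicate a 1 @ chain v bs"
  by (simp add: chain_def)

lemma chain_suffix: "\<exists>p. chain v (as @ bs) = p @ chain v bs"
  by (simp add: chain_def)

lemma chain_prefix: "\<exists>q. chain v (as @ bs) = chain v as @ q"
  by (cases bs) (auto simp: chain_append_Cons)

lemma chain_starts: "\<exists>q. chain v as = v @ q"
  using chain_prefix[of v "[]" as] by simp

lemma chain_ends: "\<exists>p. chain v as = p @ v"
  by (simp add: chain_def)

lemma built_from_iff: "built_from w v \<longleftrightarrow> (\<exists>as. as \<noteq> [] \<and> w = chain v as)"
  by (simp add: built_from_def chain_def)

text \<open>Each inner chain contributes the exponents \<open>as\<close>, and the outer exponents
  sit between these copies.\<close>

lemma chain_chain: "chain (chain v as) bs = chain v (concat (map (\<lambda>b. as @ [b]) bs) @ as)"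
  by (induction bs) (auto simp: chain_Cons chain_append_Cons)

lemma built_from_trans: "built_from w v \<Longrightarrow> built_from x w \<Longrightarrow> built_from x v"
  unfolding built_from_iff by (metis chain_chain append_is_Nil_conv)

lemma replicate_one_zero_eq:
  "replicate a (1::bit) @ 0 # xs = replicate b 1 @ 0 # ys \<Longrightarrow> a = b \<and> xs = ys"
proof (induction a arbitrary: b)
  case 0
  then show ?case by (cases b) auto
next
  case (Suc a)
  then show ?case by (cases b) auto
qed

lemma chain_zero_starts: "\<exists>q. chain [0] as = 0 # q"
  using chain_starts[of "[0]" as] by simp

lemma chain_zero_inj: "chain [0] as = chain [0] bs \<Longrightarrow> as = bs"
proof (induction as arbitrary: bs)
  case Nil
  then show ?case by (cases bs) (auto simp: chain_def)
next
  case (Cons a as)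
  then obtain b bs' where bs: "bs = b # bs'"
    by (cases bs) (auto simp: chain_def)
  obtain q q' where q: "chain [0] as = 0 # q" "chain [0] bs' = 0 # q'"
    using chain_zero_starts by metis
  with Cons.prems bs have "a = b \<and> q = q'"
    by (intro replicate_one_zero_eq) (simp add: chain_Cons)
  with Cons.IH[of bs'] q bs show ?case by simp
qed

lemma count_list_chain_zero: "count_list (chain [0] as) 0 = Suc (length as)"
  by (induction as) (auto simp: chain_Cons count_list_0_iff)

text \<open>Both chains contain equally many zeros, so \<open>p\<close> contains none; but the left
  side starts with a zero, so \<open>p\<close> is empty.\<close>

lemma chain_zero_suffix_eq:
  assumes "chain [0] bs = p @ chain [0] as" "length as = length bs"
  shows "as = bs"
proof -
  have "count_list p 0 = 0"
    using assms count_list_chain_zero[of as] count_list_chain_zero[of bs] by simp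
  then have "p = []"
    using assms(1) chain_zero_starts[of bs] by (cases p) (auto split: if_splits)
  with assms(1) show ?thesis
    using chain_zero_inj[of as bs] by simp
qed

text \<open>Lets spacer sequences over \<open>a\<close> and \<open>Suc a\<close> be treated as
  binary words, to which \<open>special_unique_language\<close> can apply again.\<close>

definition spacers :: "nat \<Rightarrow> bit list \<Rightarrow> nat list" where
  "spacers a = map (\<lambda>b. if b = 0 then a else Suc a)"

lemma spacers_append [simp]: "spacers a (u @ w) = spacers a u @ spacers a w"
  and spacers_Cons [simp]: "spacers a (b # u) = (if b = 0 then a else Suc a) # spacers a u"
  and spacers_Nil [simp]: "spacers a [] = []"
  and length_spacers [simp]: "length (spacers a u) = length u"
  by (simp_all add: spacers_def)

lemma spacers_inj: "spacers a u = spacers a w \<Longrightarrow> u = w"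
proof -
  have "inj (\<lambda>b::bit. if b = 0 then a else Suc a)"
    by (rule injI) (metis bit_not_zero_iff n_not_Suc_n)
  then show "spacers a u = spacers a w \<Longrightarrow> u = w"
    by (simp add: spacers_def inj_map_eq_map)
qed

lemma spacers_surj: "set as \<subseteq> {a, Suc a} \<Longrightarrow> \<exists>u. as = spacers a u"
proof (induction as)
  case Nil
  show ?case by (rule exI[of _ "[]"]) simp
next
  case (Cons c as)
  then obtain u where "as = spacers a u" by auto
  then have "c # as = spacers a ((if c = a then 0 else 1) # u)"
    using Cons.prems by auto
  then show ?case ..
qed

context special_unique_language
begin

lemma suffix_special:
  assumes "L ((p @ u) @ [x])" shows "L (u @ [x])"
  using factor[of p "u @ [x]" "[]"] assms by simp

text \<open>Suffixes of right special words are right special, so uniqueness identifies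
  \<open>u\<close> with the suffix of \<open>w\<close> of its length.\<close>

lemma special_suffix:
  assumes "L (u @ [0])" "L (u @ [1])" "L (w @ [0])" "L (w @ [1])" "length u \<le> length w"
  shows "\<exists>p. w = p @ u"
proof -
  define p where "p = take (length w - length u) w"
  define w' where "w' = drop (length w - length u) w"
  have w: "w = p @ w'" and "length u = length w'"
    using assms(5) by (simp_all add: p_def w'_def)
  then have "u = w'"
    using special_unique assms suffix_special by metis
  with w show ?thesis by blast
qed

text \<open>If \<open>u\<close> is right special in the derived language, then its coding followed by
  \<open>1\<^bsup>a\<^esup>\<close> is right special in \<open>L\<close>.\<close>

lemma derived_language: "special_unique_language (\<lambda>u. L (chain [0] (spacers a u)))"
proof
  fix p u q
  assume L: "L (chain [0] (spacers a (p @ u @ q)))"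
  obtain p' q' where
    "chain [0] (spacers a p @ spacers a u @ spacers a q) = p' @ chain [0] (spacers a u @ spacers a q)"
    "chain [0] (spacers a u @ spacers a q) = chain [0] (spacers a u) @ q'"
    using chain_prefix chain_suffix by metis
  with L show "L (chain [0] (spacers a u))"
    using factor[of p' "chain [0] (spacers a u)" q'] by simp
next
  fix u w :: "bit list"
  define E where "E u = chain [0] (spacers a u) @ replicate a 1" for u
  have E0: "L (E u @ [0])" if "L (chain [0] (spacers a (u @ [0])))" for u
    using that by (simp add: E_def chain_append_Cons)
  have E1: "L (E u @ [1])" if "L (chain [0] (spacers a (u @ [1])))" for u
    using that factor[of "[]" "E u @ [1]" "[0]"]
    by (simp add: E_def chain_append_Cons replicate_app_Cons_same)
  have aux: "u = w" if "\<exists>p. E w = p @ E u" "length u = length w" for u w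
  proof -
    from that(1) obtain p where "chain [0] (spacers a w) = p @ chain [0] (spacers a u)"
      by (auto simp: E_def)
    then have "spacers a u = spacers a w"
      using chain_zero_suffix_eq that(2) by simp
    then show ?thesis by (rule spacers_inj)
  qed
  assume "L (chain [0] (spacers a (u @ [0])))" "L (chain [0] (spacers a (u @ [1])))"
    "L (chain [0] (spacers a (w @ [0])))" "L (chain [0] (spacers a (w @ [1])))"
    and len: "length u = length w"
  \<comment> \<open>\<open>E u\<close> and \<open>E w\<close> may differ in length although
    \<open>u\<close> and \<open>w\<close> do not, so at first one is only known to be a suffix of
    the other; \<open>aux\<close> concludes by counting zeros.\<close>
  then have "(\<exists>p. E w = p @ E u) \<or> (\<exists>p. E u = p @ E w)"
    using special_suffix E0 E1 by (meson nat_le_linear)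
  then show "u = w"
    using aux len by metis
qed

end

section \<open>Factors of infinite words\<close>

definition occurrences :: "bit list \<Rightarrow> (nat \<Rightarrow> bit) \<Rightarrow> nat set" where
  "occurrences u V = {i. \<forall>j<length u. u ! j = V (i + j)}"

lemma eq_map_upt_iff: "u = map f [0..<length u] \<longleftrightarrow> (\<forall>j<length u. u ! j = f j)"
  by (metis (no_types, lifting) add_0 diff_zero length_map length_upt nth_equalityI nth_map_upt)

lemma subword_iff: "subword u V \<longleftrightarrow> (\<exists>i. i \<in> occurrences u V)"
  by (simp only: subword_def occurrences_def eq_map_upt_iff mem_Collect_eq)

lemma subword_Z_iff: "subword_Z u x \<longleftrightarrow> (\<exists>i. \<forall>j<length u. u ! j = x (i + int j))"
  by (simp only: subword_Z_def eq_map_upt_iff)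

lemma initial_segment_iff: "initial_segment u W \<longleftrightarrow> 0 \<in> occurrences u W"
  by (simp only: initial_segment_def occurrences_def eq_map_upt_iff mem_Collect_eq add_0)

lemma occurrences_factor:
  assumes "i \<in> occurrences (p @ u @ q) V"
  shows "i + length p \<in> occurrences u V"
  unfolding occurrences_def
proof (intro CollectI allI impI)
  fix j assume "j < length u"
  then have "(p @ u @ q) ! (length p + j) = V (i + (length p + j))"
    using assms by (simp add: occurrences_def del: nth_append_length_plus)
  with \<open>j < length u\<close> show "u ! j = V (i + length p + j)"
    by (simp add: nth_append add.assoc)
qed

lemma subword_factor: "subword (p @ u @ q) V \<Longrightarrow> subword u V"
  unfolding subword_iff using occurrences_factor by blast

text \<open>Pigeonhole on the pair of neighbouring letters; position 0 has no left neighbour and is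
  dropped.\<close>

lemma infinite_occurrences_extend:
  assumes "infinite (occurrences u V)"
  shows "\<exists>c d. infinite (occurrences (c # u @ [d]) V)"
proof -
  define A where "A = occurrences u V - {0}"
  define f where "f i = (V (i - 1), V (i + length u))" for i
  have "f ` A \<subseteq> {0, 1} \<times> {0, 1}"
    by (auto simp: f_def)
  then have "finite (f ` A)"
    by (rule finite_subset) simp
  then obtain k where k: "infinite {i \<in> A. f i = f k}"
    using assms pigeonhole_infinite[of A f] by (auto simp: A_def)
  obtain c d where cd: "f k = (c, d)" by fastforce
  have "(\<lambda>i. i - 1) ` {i \<in> A. f i = f k} \<subseteq> occurrences (c # u @ [d]) V"
  proof safe
    fix i assume "i \<in> A" "f i = f k"
    then have i: "i > 0" "\<forall>j<length u. u ! j = V (i + j)" "V (i - 1) = c" "V (i + length u) = d"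
      using cd by (auto simp: A_def f_def occurrences_def)
    show "i - 1 \<in> occurrences (c # u @ [d]) V"
      unfolding occurrences_def
    proof (intro CollectI allI impI)
      fix j assume "j < length (c # u @ [d])"
      then show "(c # u @ [d]) ! j = V (i - 1 + j)"
        using i by (cases j) (auto simp: nth_append less_Suc_eq)
    qed
  qed
  moreover have "inj_on (\<lambda>i::nat. i - 1) {i \<in> A. f i = f k}"
    by (rule inj_onI) (auto simp: A_def)
  ultimately show ?thesis
    using k by (meson finite_imageD finite_subset)
qed

text \<open>Repeated extension on both sides gives nested words that exhaust a two-sided sequence.
  Each of its factors lies in one of them, hence in \<open>V\<close>.\<close>

lemma infinite_occurrences_in_subshift:
  assumes "infinite (occurrences u V)"
  shows "\<exists>x\<in>subshift V. subword_Z u x"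
proof -
  obtain f where f0: "f 0 = u" and inf: "\<And>n. infinite (occurrences (f n) V)"
    and step: "\<And>n. \<exists>c d. f (Suc n) = c # f n @ [d]"
  proof -
    have "\<exists>f. \<forall>n. (infinite (occurrences (f n) V) \<and> (n = 0 \<longrightarrow> f n = u)) \<and>
      (\<exists>c d. f (Suc n) = c # f n @ [d])"
      using assms infinite_occurrences_extend
      by (intro dependent_nat_choice) blast+
    then show ?thesis using that by blast
  qed
  have len: "length (f n) = length u + 2 * n" for n
  proof (induction n)
    case (Suc n)
    then show ?case using step[of n] by auto
  qed (simp add: f0)
  have shift_index: "f (n + m) ! (j + m) = f n ! j" if "j < length (f n)" for n m j
  proof (induction m)
    case (Suc m)
    obtain c d where "f (Suc (n + m)) = c # f (n + m) @ [d]"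
      using step by blast
    moreover have "j + m < length (f (n + m))"
      using that by (simp add: len)
    ultimately show ?case using Suc by (simp add: nth_append)
  qed simp
  \<comment> \<open>The origin is the start of \<open>u\<close>, at index \<open>n\<close> of
    \<open>f n\<close>; stage \<open>Suc (nat \<bar>k\<bar>)\<close> reaches position
    \<open>k\<close>.\<close>
  define x where "x k = f (Suc (nat \<bar>k\<bar>)) ! nat (int (Suc (nat \<bar>k\<bar>)) + k)" for k :: int
  have x: "x k = f n ! nat (int n + k)" if k: "- int n \<le> k" "k < int (length u + n)" for n k
  proof -
    define m where "m = Suc (nat \<bar>k\<bar>)"
    have m: "nat (int m + k) < length (f m)" "nat (int n + k) < length (f n)"
      using k by (auto simp: m_def len)
    show ?thesis
    proof (cases "m \<le> n")
      case True
      then have "f n ! (nat (int m + k) + (n - m)) = f m ! nat (int m + k)"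
        using shift_index[OF m(1), of "n - m"] by simp
      moreover have "nat (int m + k) + (n - m) = nat (int n + k)"
        using True k by (auto simp: m_def)
      ultimately show ?thesis by (simp add: x_def m_def)
    next
      case False
      then have "f m ! (nat (int n + k) + (m - n)) = f n ! nat (int n + k)"
        using shift_index[OF m(2), of "m - n"] by simp
      moreover have "nat (int n + k) + (m - n) = nat (int m + k)"
        using False k by (auto simp: m_def)
      ultimately show ?thesis by (simp add: x_def m_def)
    qed
  qed
  have "subword_Z u x"
    unfolding subword_Z_iff
  proof (intro exI allI impI)
    fix j assume "j < length u"
    then show "u ! j = x (0 + int j)"
      using x[of 0 "int j"] f0 by simp
  qed
  moreover have "x \<in> subshift V"
    unfolding subshift_def
  proof (intro CollectI allI impI)
    fix w assume "subword_Z w x"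
    then obtain i where i: "\<forall>j<length w. w ! j = x (i + int j)"
      by (auto simp: subword_Z_iff)
    define n where "n = nat \<bar>i\<bar> + length w"
    obtain k where k: "k \<in> occurrences (f n) V"
      using infinite_imp_nonempty[OF inf[of n]] by blast
    have "k + nat (int n + i) \<in> occurrences w V"
      unfolding occurrences_def
    proof (intro CollectI allI impI)
      fix j assume j: "j < length w"
      have idx: "nat (int n + (i + int j)) = nat (int n + i) + j"
        "nat (int n + (i + int j)) < length (f n)"
        using j by (auto simp: n_def len)
      have "w ! j = f n ! nat (int n + (i + int j))"
        using i j x[of n "i + int j"] by (simp add: n_def)
      also have "\<dots> = V (k + nat (int n + (i + int j)))"
        using k idx(2) by (simp add: occurrences_def)
      finally show "w ! j = V (k + nat (int n + i) + j)"
        by (simp add: idx(1) add.assoc)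
    qed
    then show "subword w V"
      by (auto simp: subword_iff)
  qed
  ultimately show ?thesis by blast
qed

section \<open>Sturmian words\<close>

lemma sturmian_special_unique:
  assumes V: "sturmian V"
  shows "special_unique_language (\<lambda>u. subword u V)"
proof
  show "subword u V" if "subword (p @ u @ q) V" for p u q
    using that by (rule subword_factor)
next
  fix u w
  assume L: "subword (u @ [0]) V" "subword (u @ [1]) V" "subword (w @ [0]) V" "subword (w @ [1]) V"
    and len: "length u = length w"
  define F where "F n = {u. length u = n \<and> subword u V}" for n
  have card: "card (F n) = n + 1" for n
    using V by (simp add: F_def sturmian_def)
  \<comment> \<open>An infinite set would have cardinality 0.\<close>
  then have fin: "finite (F n)" for n
    by (metis card.infinite Suc_eq_plus1 nat.distinct(1))
  define n where "n = length u"
  \<comment> \<open>Since 0 is preferred, \<open>u @ [1]\<close> and \<open>w @ [1]\<close> are not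
    values of \<open>e\<close>. Together with the \<open>n + 1\<close> values on \<open>F n\<close>
    they would make \<open>n + 3\<close> words of length \<open>n + 1\<close>, one too many.\<close>
  define e where "e t = t @ [if subword (t @ [0]) V then 0 else 1]" for t
  have length_e: "length (e t) = Suc (length t)" for t
    by (simp add: e_def)
  have e: "subword (e t) V" if t: "subword t V" for t
  proof -
    obtain i where i: "i \<in> occurrences t V"
      using t subword_iff by blast
    have "i \<in> occurrences (t @ [V (i + length t)]) V"
      using i by (auto simp: occurrences_def nth_append less_Suc_eq)
    then have s: "subword (t @ [V (i + length t)]) V"
      using subword_iff by blast
    show ?thesis
      using s by (cases "V (i + length t)") (auto simp: e_def)
  qed
  show "u = w"
  proof (rule ccontr)
    assume "u \<noteq> w"
    have "e ` F n \<union> {u @ [1], w @ [1]} \<subseteq> F (Suc n)"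
    proof (rule Un_least)
      show "e ` F n \<subseteq> F (Suc n)"
        using e by (auto simp: F_def length_e)
      show "{u @ [1], w @ [1]} \<subseteq> F (Suc n)"
        using L len by (simp add: F_def n_def)
    qed
    then have "card (e ` F n \<union> {u @ [1], w @ [1]}) \<le> Suc n + 1"
      using card_mono[OF fin] card by metis
    moreover have "e ` F n \<inter> {u @ [1], w @ [1]} = {}"
      using L by (auto simp: e_def)
    then have "card (e ` F n \<union> {u @ [1], w @ [1]}) = card (e ` F n) + 2"
      using fin \<open>u \<noteq> w\<close> by (subst card_Un_disjoint) auto
    moreover have "inj_on e (F n)"
      by (rule inj_onI) (simp add: e_def)
    then have "card (e ` F n) = n + 1"
      by (simp add: card_image card)
    ultimately show False by simp
  qed
qed

lemma sturmian_not_eventually_periodic: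
  assumes "sturmian V" "p > 0"
  shows "infinite {n. V (n + p) \<noteq> V n}"
proof
  assume "finite {n. V (n + p) \<noteq> V n}"
  then obtain N where N: "\<And>n. n \<ge> N \<Longrightarrow> V (n + p) = V n"
    by (metis (mono_tags, lifting) finite_nat_set_iff_bounded mem_Collect_eq not_le)
  \<comment> \<open>\<open>m\<close> is both the window length and a bound on starting positions:
    every window already starts before \<open>m\<close>, so there are at most \<open>m\<close> of
    them.\<close>
  define m where "m = N + p"
  define g where "g i = map (\<lambda>j. V (i + j)) [0..<m]" for i
  have g: "g i \<in> g ` {..<m}" for i
  proof (induction i rule: less_induct)
    case (less i)
    show ?case
    proof (cases "i < m")
      case False
      then have "V (i + j) = V (i - p + j)" for j
        using N[of "i - p + j"] by (simp add: m_def)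
      then have "g i = g (i - p)"
        by (simp add: g_def)
      then show ?thesis
        using less[of "i - p"] False \<open>p > 0\<close> by (simp add: m_def)
    qed auto
  qed
  have "{u. length u = m \<and> subword u V} \<subseteq> g ` {..<m}"
  proof
    fix u assume "u \<in> {u. length u = m \<and> subword u V}"
    then obtain i where "u = g i"
      unfolding subword_def g_def by blast
    then show "u \<in> g ` {..<m}"
      using g by simp
  qed
  then have "card {u. length u = m \<and> subword u V} \<le> m"
    using surj_card_le[of "{..<m}"] by simp
  then show False
    using assms(1) by (simp add: sturmian_def)
qed

text \<open>Some window of length \<open>p + 1\<close> whose end letters differ recurs infinitely
  often in \<open>V\<close>. It therefore occurs in the subshift and so in \<open>W\<close>, where
  it violates the period \<open>p\<close>.\<close>

lemma sturmian_subshift_not_periodic: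
  assumes V: "sturmian V" and sub: "subshift V \<subseteq> subshift W" and "p > 0"
  shows "\<exists>n. W (n + p) \<noteq> W n"
proof -
  define A where "A = {n. V (n + p) \<noteq> V n}"
  define g where "g i = map (\<lambda>j. V (i + j)) [0..<Suc p]" for i
  have "g ` A \<subseteq> {u. set u \<subseteq> {0, 1} \<and> length u = Suc p}"
    by (auto simp: g_def simp del: upt_Suc)
  then have "finite (g ` A)"
    using finite_lists_length_eq[of "{0, 1::bit}"] finite_subset by blast
  moreover have "infinite A"
    unfolding A_def by (rule sturmian_not_eventually_periodic[OF V \<open>p > 0\<close>])
  ultimately obtain k where k: "k \<in> A" "infinite {i \<in> A. g i = g k}"
    using pigeonhole_infinite by blast
  have "{i \<in> A. g i = g k} \<subseteq> occurrences (g k) V"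
  proof safe
    fix i assume "g i = g k"
    moreover have "i \<in> occurrences (g i) V"
      by (simp add: occurrences_def g_def del: upt_Suc)
    ultimately show "i \<in> occurrences (g k) V" by simp
  qed
  then have "infinite (occurrences (g k) V)"
    using k(2) finite_subset by blast
  then obtain x where "x \<in> subshift V" "subword_Z (g k) x"
    using infinite_occurrences_in_subshift by blast
  then have "subword (g k) W"
    using sub by (auto simp: subshift_def)
  then obtain i where i: "\<forall>j<Suc p. g k ! j = W (i + j)"
    by (auto simp: subword_iff occurrences_def g_def simp del: upt_Suc)
  have "W (i + p) = V (k + p)" "W i = V k"
    using i[rule_format, of p] i[rule_format, of 0] by (simp_all add: g_def nth_append del: upt_Suc)
  then show ?thesis
    using k(1) unfolding A_def by (metis (mono_tags) mem_Collect_eq)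
qed

section \<open>Rank-one constructions\<close>

text \<open>Removing the first block with its spacer and removing the last one leave the same word
  \<open>C\<close>.\<close>

lemma chain_replicate_nth_add:
  assumes "n + (length v + s) < length (chain v (replicate k s))"
  shows "chain v (replicate k s) ! (n + (length v + s)) = chain v (replicate k s) ! n"
proof (cases k)
  case 0
  with assms show ?thesis by simp
next
  case (Suc k')
  define C where "C = chain v (replicate k' s)"
  have 1: "chain v (replicate k s) = (v @ replicate s 1) @ C"
    by (simp add: Suc C_def chain_Cons)
  obtain q where 2: "chain v (replicate k s) = C @ q"
    using chain_prefix[of v "replicate k' s" "[s]"]
    by (auto simp: Suc C_def replicate_append_same)
  have "n < length C"
    using assms 1 by simp
  then have "((v @ replicate s 1) @ C) ! (n + (length v + s)) = (C @ q) ! n"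
    by (simp add: nth_append)
  then show ?thesis
    using 1 2 by metis
qed

locale rank_one_construction =
  fixes W :: "nat \<Rightarrow> bit" and v :: "nat \<Rightarrow> bit list"
  assumes words: "v i \<in> rank_one_words" and v_0: "v 0 = [0]"
    and built_Suc: "built_from (v (Suc i)) (v i)" and initial: "initial_segment (v i) W"
begin

lemma v_starts: "\<exists>q. v i = 0 # q"
  using words[of i] by (cases "v i") (auto simp: rank_one_words_def)

lemma v_ends: "\<exists>p. v i = p @ [0]"
  using words[of i] by (cases "v i" rule: rev_cases) (auto simp: rank_one_words_def)

lemma built: "i < j \<Longrightarrow> built_from (v j) (v i)"
  by (induction rule: less_Suc_induct) (auto intro: built_Suc built_from_trans)

lemma obtain_chain:
  assumes "i < j"
  obtains as where "as \<noteq> []" "v j = chain (v i) as"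
  using built[OF assms] by (auto simp: built_from_iff)

lemma index_less_length: "i < length (v i)"
proof (induction i)
  case (Suc i)
  obtain a as where "v (Suc i) = chain (v i) (a # as)"
    using obtain_chain[of i "Suc i"] by (metis lessI neq_Nil_conv)
  moreover obtain q where "chain (v i) as = v i @ q"
    using chain_starts by blast
  ultimately have "length (v (Suc i)) \<ge> length (v i) + length (v i)"
    by (simp add: chain_Cons)
  with Suc show ?case by simp
qed (simp add: v_0)

lemma v_nth: "n < length (v i) \<Longrightarrow> v i ! n = W n"
  using initial[of i] by (simp add: initial_segment_iff occurrences_def)

lemma subword_if_factor: "v j = p @ u @ q \<Longrightarrow> subword u W"
  using initial[of j] subword_factor by (metis initial_segment_iff subword_iff)

lemma subword_imp_factor:
  assumes "subword u W"
  shows "\<exists>j p q. v j = p @ u @ q"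
proof -
  obtain i where i: "i \<in> occurrences u W"
    using assms subword_iff by blast
  define j where "j = i + length u"
  have j: "i + length u < length (v j)"
    using index_less_length[of j] by (simp add: j_def)
  have "take (length u) (drop i (v j)) = u"
    using i j by (intro nth_equalityI) (auto simp: v_nth occurrences_def)
  then show ?thesis
    by (metis append_take_drop_id)
qed

lemma infinite_occurrences:
  assumes "subword u W"
  shows "infinite (occurrences u W)"
  unfolding infinite_nat_iff_unbounded
proof
  fix m
  obtain j p q where vj: "v j = p @ u @ q"
    using subword_imp_factor[OF assms] by blast
  \<comment> \<open>Large enough that the part of \<open>v k\<close> before its final copy of
    \<open>v j\<close> is longer than \<open>m\<close>.\<close>
  define k where "k = Suc (m + j + length (v j))"
  have "j < k" by (simp add: k_def)
  then obtain r where vk: "v k = r @ v j"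
    using obtain_chain chain_ends by metis
  have "0 + length (r @ p) \<in> occurrences u W"
    using initial[of k] vj vk occurrences_factor[of 0 "r @ p" u q W]
    by (simp add: initial_segment_iff)
  moreover have "m < length r"
    using index_less_length[of k] vk by (simp add: k_def)
  ultimately show "\<exists>n>m. n \<in> occurrences u W"
    by (intro exI[of _ "length (r @ p)"]) simp
qed

lemma subword_in_subshift:
  assumes "subword u W" "subshift W \<subseteq> subshift V"
  shows "subword u V"
proof -
  obtain x where "x \<in> subshift W" "subword_Z u x"
    using infinite_occurrences_in_subshift infinite_occurrences[OF assms(1)] by blast
  with assms(2) show ?thesis
    by (auto simp: subshift_def)
qed

lemma spacer_occurs:
  assumes "v j = chain (v i) as" "s \<in> set as"
  shows "subword (v i @ replicate s 1 @ v i) W"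
proof -
  obtain bs cs where "as = bs @ s # cs"
    using assms(2) by (meson split_list)
  moreover obtain p where "chain (v i) bs = p @ v i"
    using chain_ends by blast
  moreover obtain q where "chain (v i) cs = v i @ q"
    using chain_starts by blast
  ultimately have "v j = p @ (v i @ replicate s 1 @ v i) @ q"
    using assms(1) by (simp add: chain_append_Cons)
  then show ?thesis by (rule subword_if_factor)
qed

lemma spacer_occurs_zero:
  assumes "subword (v i @ replicate s 1 @ v i) W"
  shows "subword (0 # replicate s 1 @ [0]) W"
proof -
  obtain p q where "v i = p @ [0]" "v i = 0 # q"
    using v_starts v_ends by metis
  then have "v i @ replicate s 1 @ v i = p @ (0 # replicate s 1 @ [0]) @ q"
    by (metis append.assoc append_Cons append_Nil)
  with assms show ?thesis
    using subword_factor by metis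
qed

text \<open>Otherwise a single spacer \<open>s\<close> separates the copies of \<open>v i\<close> in
  all later words, because these all begin with \<open>v (Suc i)\<close>; then \<open>W\<close> has
  period \<open>length (v i) + s\<close>.\<close>

lemma distinct_spacers:
  assumes aper: "\<And>p. p > 0 \<Longrightarrow> \<exists>n. W (n + p) \<noteq> W n"
  shows "\<exists>j as s t. v j = chain (v i) as \<and> s \<in> set as \<and> t \<in> set as \<and> s \<noteq> t"
proof (rule ccontr)
  assume "\<not> ?thesis"
  then have same: "t = s" if "v j = chain (v i) as" "s \<in> set as" "t \<in> set as" for j as s t
    using that by blast
  obtain s as0 where s: "v (Suc i) = chain (v i) (s # as0)"
    using obtain_chain[of i "Suc i"] by (metis lessI neq_Nil_conv)
  have const: "\<exists>k. v j = chain (v i) (replicate k s)" if ij: "Suc i < j" for j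
  proof -
    obtain t as where t: "v j = chain (v i) (t # as)"
      using ij obtain_chain[of i j] by (metis Suc_lessD neq_Nil_conv)
    obtain bs where "v j = chain (v (Suc i)) bs"
      by (rule obtain_chain[OF ij])
    then obtain q where q: "v j = v (Suc i) @ q"
      using chain_starts[of "v (Suc i)" bs] by auto
    obtain x y where "chain (v i) as = 0 # x" "chain (v i) as0 = 0 # y"
      using chain_starts[of "v i"] v_starts[of i] by (metis append_Cons)
    then have "replicate t 1 @ 0 # x = replicate s 1 @ 0 # (y @ q)"
      using q s t by (simp add: chain_Cons)
    then have "t = s"
      using replicate_one_zero_eq by blast
    then have "t # as = replicate (length (t # as)) s"
      using same[OF t] by (metis list.set_intros(1) replicate_eqI)
    with t show ?thesis by metis
  qed
  define p where "p = length (v i) + s"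
  have "p > 0"
    using v_starts[of i] by (auto simp: p_def)
  then obtain n where n: "W (n + p) \<noteq> W n"
    using aper by blast
  define j where "j = Suc (Suc i) + n + p"
  obtain k where k: "v j = chain (v i) (replicate k s)"
    using const[of j] by (auto simp: j_def)
  have "n + p < length (v j)"
    using index_less_length[of j] by (simp add: j_def)
  then have "W (n + p) = W n"
    using chain_replicate_nth_add[of n "v i" s k] v_nth[of "n + p" j] v_nth[of n j]
    by (simp add: k p_def)
  with n show False ..
qed

lemma periodic_if_special_unique:
  assumes "special_unique_language (\<lambda>u. subword u W)"
  shows "\<exists>p>0. \<forall>n. W (n + p) = W n"
proof (rule ccontr)
  assume "\<not> ?thesis"
  then have aper: "\<exists>n. W (n + p) \<noteq> W n" if "p > 0" for p
    using that by blast
  interpret special_unique_language "\<lambda>u. subword u W" by fact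
  define a where "a = (LEAST s. subword (0 # replicate s 1 @ [0]) W)"
  have range: "s \<in> {a, Suc a}" if s: "subword (0 # replicate s 1 @ [0]) W" for s
  proof -
    have "subword (0 # replicate a 1 @ [0]) W" "a \<le> s"
      unfolding a_def using s by (rule LeastI, rule Least_le)
    then show ?thesis
      using run_length_le[OF _ _ s, of a] by auto
  qed
  obtain j as s t where j: "v j = chain (v 0) as" "s \<in> set as" "t \<in> set as" "s \<noteq> t"
    using distinct_spacers[OF aper] by blast
  have "set as \<subseteq> {a, Suc a}"
    using spacer_occurs[OF j(1)] spacer_occurs_zero range by blast
  then obtain u where u: "as = spacers a u"
    using spacers_surj by blast
  have both: "0 \<in> set u" "1 \<in> set u"
    using j(2-4) unfolding u spacers_def by (auto split: if_splits)
  \<comment> \<open>The same lemma one level up: the two spacers between copies of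
    \<open>v j\<close> also lie in \<open>{a, Suc a}\<close>, so both values occur there.\<close>
  obtain j' as' s' t' where j': "v j' = chain (v j) as'" "s' \<in> set as'" "t' \<in> set as'" "s' \<noteq> t'"
    using distinct_spacers[OF aper] by blast
  have "subword (v j @ replicate s' 1 @ v j) W" "subword (v j @ replicate t' 1 @ v j) W"
    using spacer_occurs[OF j'(1)] j' by blast+
  moreover from this have "{s', t'} = {a, Suc a}"
    using spacer_occurs_zero range j'(4) by blast
  ultimately have "subword (v j @ replicate a 1 @ v j) W" "subword (v j @ replicate (Suc a) 1 @ v j) W"
    by (auto simp: doubleton_eq_iff)
  then have "subword (chain [0] (spacers a (u @ 0 # u))) W"
    "subword (chain [0] (spacers a (u @ 1 # u))) W"
    by (simp_all add: chain_append_Cons j(1) u v_0)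
  then show False
    using special_unique_language.no_word_with_both_extensions[OF derived_language both] by blast
qed

end

theorem proposition5p5:
  fixes V :: "nat \<Rightarrow> bit"
  assumes "sturmian V"
  shows "\<not> rank_one_system (shift_system V)"
proof
  assume "rank_one_system (shift_system V)"
  then obtain W v where "rank_one_construction W v" and eq: "subshift V = subshift W"
    unfolding rank_one_system_def has_rank_one_construction_def shift_system_def
      rank_one_construction_def by auto
  then interpret rank_one_construction W v by simp
  have sub: "subword u V" if "subword u W" for u
    using subword_in_subshift that eq by simp
  interpret V: special_unique_language "\<lambda>u. subword u V"
    using assms by (rule sturmian_special_unique)
  \<comment> \<open>A right special factor of \<open>W\<close> is right special in \<open>V\<close>,
    so uniqueness carries over.\<close>
  have "special_unique_language (\<lambda>u. subword u W)"
    by standard (blast intro: subword_factor sub V.special_unique)+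
  then show False
    using periodic_if_special_unique sturmian_subshift_not_periodic[OF assms] eq by blast
qed

end
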